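(* Let $(X,x)$ be a pointed topological space and let $\mathbf{p}:(X,x)\to((X_\lambda,x_\lambda),p_{\lambda\lambda'},\Lambda)$ be an $\mathrm{HPol}_*$-expansion of $(X,x)$. Then for every integer $k\ge1$, the natural map $q:\check{\Omega}_k(X,x)\to\check{\pi}_k^{top}(X,x)$, $q((a_\lambda))=\langle[(a_\lambda)]\rangle$, is a quotient map. In other words, the topology of $\check{\pi}_k^{top}(X,x)$ agrees with the quotient topology on $\check{\pi}_k(X,x)$ induced by $q$.
   Context: $\mathrm{HTop}_*$ is the pointed homotopy category of pointed topological spaces; $\mathrm{HPol}_*$ is its full subcategory of pointed spaces having the pointed homotopy type of a pointed polyhedron. Inverse systems are indexed by directed sets. An $\mathrm{HPol}_*$-expansion of $(X,x)$ is an inverse system $(\mathbf{X},\mathbf{x})=((X_\lambda,x_\lambda),p_{\lambda\lambda'},\Lambda)$ in $\mathrm{HPol}_*$ with a morphism $\mathbf{p}=(p_\lambda):(X,x)\to(\mathbf{X},\mathbf{x})$ of pro-$\mathrm{HTop}_*$ (so $p_{\lambda\lambda'}p_{\lambda'}=p_\lambda$ in $\mathrm{HTop}_*$) such that: (E1) for every $P\in \mathrm{HPol}_*$ and every $h:(X,x)\to P$ in $\mathrm{HTop}_*$ there are $\lambda\in\Lambda$ and $f:(X_\lambda,x_\lambda)\to P$ with $fp_\lambda= h$; (E2) if $f_0,f_1:(X_\lambda,x_\lambda)\to P$ satisfy $f_0p_\lambda= f_1p_\lambda$, then $f_0p_{\lambda\lambda'}= f_1p_{\lambda\lambda'}$ for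 some $\lambda'\ge\lambda$. A shape morphism $F:(S^k,* )\to(X,x)$ is, with an expansion of $(X,x)$ fixed, a family $(f_\lambda)_{\lambda\in\Lambda}$ of pointed homotopy classes $f_\lambda:(S^k,* )\to(X_\lambda,x_\lambda)$ with $p_{\lambda\lambda'}f_{\lambda'}=f_\lambda$ for $\lambda\le\lambda'$ (families for different expansions are identified via the canonical isomorphism of expansions), and $p_\lambda\circ F=f_\lambda$. The $k$th shape group $\check{\pi}_k(X,x)=Sh((S^k,* ),(X,x))$ is the set of these shape morphisms with operation $F+G$ represented by $(f_\lambda+g_\lambda)_\lambda$ (product in $\pi_k(X_\lambda,x_\lambda)$). $\check{\pi}_k^{top}(X,x)$ is this group with the topology having as basis the sets $V_\lambda^F=\{G : p_\lambda\circ F=p_\lambda\circ G \text{ as pointed homotopy classes to } X_\lambda\}$, $F\in Sh((S^k,* ),(X,x))$, $\lambda\in\Lambda$. It is a topological group and does not depend on the choice of expansion. $\Omega^k(X_\lambda,x_\lambda)$ is the $k$th loop space of $(X_\lambda,x_\lambda)$ (pointed maps $(S^k,* )\to(X_\lambda,x_\lambda)$) with the compact-open topology. A $k$-shape loop in $X$ is an element $(a_\lambda)\in\prod_{\lambda\in\Lambda}\Omega^k(X_\lambda,x_\lambda)$ such that $p_{\lambda\lambda'}(a_{\lambda'})\simeq a_\lambda$ (pointed homotopy) for all $\lambda'\ge\lambda$. The $k$th shape loop space $\check{\Omega}_k(X,x)$ is the set of all $k$-shape loops, with the subspace topology from $\prod_{\lambda\in\Lambda}\Omega^k(X_\lambda,x_\lambda)$.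 $\langle[(a_\lambda)]\rangle$ denotes the shape morphism $(S^k,* )\to(X,x)$ given by the family of pointed homotopy classes of the $a_\lambda$. *)

theory Defs
  imports "HOL-Analysis.Analysis"
begin

section \<open>The pointed homotopy category\<close>

type_synonym 'a ptd = "'a topology \<times> 'a"

definition ptd_space :: "'a ptd \<Rightarrow> bool" where
  "ptd_space X \<longleftrightarrow> snd X \<in> topspace (fst X)"

definition ptd_map :: "'a ptd \<Rightarrow> 'b ptd \<Rightarrow> ('a \<Rightarrow> 'b) \<Rightarrow> bool" where
  "ptd_map X Y f \<longleftrightarrow> continuous_map (fst X) (fst Y) f \<and> f (snd X) = snd Y"

definition ptd_homotopic :: "'a ptd \<Rightarrow> 'b ptd \<Rightarrow> ('a \<Rightarrow> 'b) \<Rightarrow> ('a \<Rightarrow> 'b) \<Rightarrow> bool" where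
  "ptd_homotopic X Y f g \<longleftrightarrow> homotopic_with (\<lambda>h. h (snd X) = snd Y) (fst X) (fst Y) f g"

text \<open>Maps are total functions whose values outside the carrier are irrelevant: functions that
  agree on the carrier lie in the same class.\<close>

definition hclass :: "'a ptd \<Rightarrow> 'b ptd \<Rightarrow> ('a \<Rightarrow> 'b) \<Rightarrow> ('a \<Rightarrow> 'b) set" where
  "hclass X Y f = {g. ptd_homotopic X Y f g}"

definition hhom :: "'a ptd \<Rightarrow> 'b ptd \<Rightarrow> ('a \<Rightarrow> 'b) set set" where
  "hhom X Y = {hclass X Y f | f. ptd_map X Y f}"

definition hid :: "'a ptd \<Rightarrow> ('a \<Rightarrow> 'a) set" where
  "hid X = hclass X X id"

definition hcomp :: "'a ptd \<Rightarrow> 'c ptd \<Rightarrow> ('b \<Rightarrow> 'c) set \<Rightarrow> ('a \<Rightarrow> 'b) set \<Rightarrow> ('a \<Rightarrow> 'c) set" where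
  "hcomp X Z G F = (\<Union>g\<in>G. \<Union>f\<in>F. hclass X Z (g \<circ> f))"

lemma ptd_homotopic_imp_maps:
  assumes "ptd_homotopic X Y f g"
  shows "ptd_map X Y f" "ptd_map X Y g"
  using assms homotopic_with_imp_continuous_maps homotopic_with_imp_property
  unfolding ptd_homotopic_def ptd_map_def by blast+

lemma ptd_homotopic_refl: "ptd_homotopic X Y f f \<longleftrightarrow> ptd_map X Y f"
  by (auto simp: ptd_homotopic_def ptd_map_def homotopic_with_refl)

lemma ptd_homotopic_sym: "ptd_homotopic X Y f g \<Longrightarrow> ptd_homotopic X Y g f"
  by (simp add: ptd_homotopic_def homotopic_with_sym)

lemma ptd_homotopic_trans:
  "ptd_homotopic X Y f g \<Longrightarrow> ptd_homotopic X Y g h \<Longrightarrow> ptd_homotopic X Y f h"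
  unfolding ptd_homotopic_def by (rule homotopic_with_trans)

lemma hclass_eq_iff:
  assumes "ptd_map X Y f"
  shows "hclass X Y f = hclass X Y g \<longleftrightarrow> ptd_homotopic X Y f g"
  using assms ptd_homotopic_refl ptd_homotopic_sym ptd_homotopic_trans
  unfolding hclass_def by blast

lemma ptd_homotopic_comp:
  assumes "ptd_homotopic X Y f f'" "ptd_homotopic Y Z g g'"
  shows "ptd_homotopic X Z (g \<circ> f) (g' \<circ> f')"
proof -
  have "ptd_map X Y f" "ptd_map X Y f'" "ptd_map Y Z g" "ptd_map Y Z g'"
    using assms ptd_homotopic_imp_maps by blast+
  then have "ptd_homotopic X Z (g \<circ> f) (g \<circ> f')" "ptd_homotopic X Z (g \<circ> f') (g' \<circ> f')"
    using assms unfolding ptd_homotopic_def ptd_map_def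
    by (auto intro!: homotopic_with_compose_continuous_map_left
        homotopic_with_compose_continuous_map_right)
  then show ?thesis
    by (rule ptd_homotopic_trans)
qed

lemma hcomp_hclass:
  assumes "ptd_map X Y f" "ptd_map Y Z g"
  shows "hcomp X Z (hclass Y Z g) (hclass X Y f) = hclass X Z (g \<circ> f)"
proof -
  have "hclass X Z (g' \<circ> f') = hclass X Z (g \<circ> f)"
    if "g' \<in> hclass Y Z g" "f' \<in> hclass X Y f" for g' f'
  proof -
    have "ptd_homotopic X Z (g' \<circ> f') (g \<circ> f)"
      using that unfolding hclass_def
      by (auto intro: ptd_homotopic_sym ptd_homotopic_comp)
    then show ?thesis
      using hclass_eq_iff ptd_homotopic_imp_maps(1) by blast
  qed
  moreover have "g \<in> hclass Y Z g" "f \<in> hclass X Y f"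
    using assms by (auto simp: hclass_def ptd_homotopic_refl)
  ultimately show ?thesis
    unfolding hcomp_def by blast
qed


section \<open>Pointed polyhedra and \<open>HPol\<^sub>*\<close>\<close>

definition abstract_simplicial_complex :: "'v set set \<Rightarrow> bool" where
  "abstract_simplicial_complex K \<longleftrightarrow>
     (\<forall>\<sigma>\<in>K. finite \<sigma> \<and> \<sigma> \<noteq> {}) \<and> (\<forall>\<sigma>\<in>K. \<forall>\<tau>. \<tau> \<subseteq> \<sigma> \<and> \<tau> \<noteq> {} \<longrightarrow> \<tau> \<in> K)"

text \<open>Points of a closed simplex are given by their barycentric coordinates.\<close>

definition closed_simplex :: "'v set \<Rightarrow> ('v \<Rightarrow> real) set" where
  "closed_simplex \<sigma> = {t. (\<forall>v. 0 \<le> t v) \<and> (\<forall>v. v \<notin> \<sigma> \<longrightarrow> t v = 0) \<and> sum t \<sigma> = 1}"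

text \<open>The weak (CW) topology. On each closed simplex the topology of pointwise convergence, used
  here, is the Euclidean one.\<close>

definition polyhedron :: "'v set set \<Rightarrow> ('v \<Rightarrow> real) topology" where
  "polyhedron K = topology (\<lambda>U. U \<subseteq> (\<Union>\<sigma>\<in>K. closed_simplex \<sigma>) \<and>
     (\<forall>\<sigma>\<in>K. openin (top_of_set (closed_simplex \<sigma>)) (U \<inter> closed_simplex \<sigma>)))"

lemma openin_polyhedron:
  "openin (polyhedron K) U \<longleftrightarrow> U \<subseteq> (\<Union>\<sigma>\<in>K. closed_simplex \<sigma>) \<and>
     (\<forall>\<sigma>\<in>K. openin (top_of_set (closed_simplex \<sigma>)) (U \<inter> closed_simplex \<sigma>))"
proof -
  have "istopology (\<lambda>U. U \<subseteq> (\<Union>\<sigma>\<in>K. closed_simplex \<sigma>) \<and>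
     (\<forall>\<sigma>\<in>K. openin (top_of_set (closed_simplex \<sigma>)) (U \<inter> closed_simplex \<sigma>)))"
    unfolding istopology_def
  proof (rule conjI; intro allI impI conjI ballI)
    fix S T \<sigma>
    assume S: "S \<subseteq> (\<Union>\<sigma>\<in>K. closed_simplex \<sigma>) \<and>
        (\<forall>\<sigma>\<in>K. openin (top_of_set (closed_simplex \<sigma>)) (S \<inter> closed_simplex \<sigma>))"
      and T: "T \<subseteq> (\<Union>\<sigma>\<in>K. closed_simplex \<sigma>) \<and>
        (\<forall>\<sigma>\<in>K. openin (top_of_set (closed_simplex \<sigma>)) (T \<inter> closed_simplex \<sigma>))"
    show "S \<inter> T \<subseteq> (\<Union>\<sigma>\<in>K. closed_simplex \<sigma>)"
      using S by blast
    assume "\<sigma> \<in> K"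
    with S T have "openin (top_of_set (closed_simplex \<sigma>))
        ((S \<inter> closed_simplex \<sigma>) \<inter> (T \<inter> closed_simplex \<sigma>))"
      by blast
    then show "openin (top_of_set (closed_simplex \<sigma>)) (S \<inter> T \<inter> closed_simplex \<sigma>)"
      by (simp add: Int_ac)
  next
    fix \<U> :: "('a \<Rightarrow> real) set set" and \<sigma>
    assume U: "\<forall>U\<in>\<U>. U \<subseteq> (\<Union>\<sigma>\<in>K. closed_simplex \<sigma>) \<and>
        (\<forall>\<sigma>\<in>K. openin (top_of_set (closed_simplex \<sigma>)) (U \<inter> closed_simplex \<sigma>))"
    show "\<Union>\<U> \<subseteq> (\<Union>\<sigma>\<in>K. closed_simplex \<sigma>)"
      using U by blast
    assume "\<sigma> \<in> K"
    with U have "openin (top_of_set (closed_simplex \<sigma>)) (\<Union>U\<in>\<U>. U \<inter> closed_simplex \<sigma>)"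
      by blast
    then show "openin (top_of_set (closed_simplex \<sigma>)) (\<Union>\<U> \<inter> closed_simplex \<sigma>)"
      by (simp add: Int_commute Int_Union)
  qed
  then show ?thesis
    by (simp add: polyhedron_def topology_inverse')
qed

lemma topspace_polyhedron: "topspace (polyhedron K) = (\<Union>\<sigma>\<in>K. closed_simplex \<sigma>)"
proof
  show "topspace (polyhedron K) \<subseteq> (\<Union>\<sigma>\<in>K. closed_simplex \<sigma>)"
    using openin_polyhedron openin_topspace by blast
  have "(\<Union>\<sigma>\<in>K. closed_simplex \<sigma>) \<inter> closed_simplex \<tau> = closed_simplex \<tau>" if "\<tau> \<in> K" for \<tau>
    using that by blast
  then have "openin (polyhedron K) (\<Union>\<sigma>\<in>K. closed_simplex \<sigma>)"
    by (simp add: openin_polyhedron)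
  then show "(\<Union>\<sigma>\<in>K. closed_simplex \<sigma>) \<subseteq> topspace (polyhedron K)"
    by (rule openin_subset)
qed

text \<open>The type argument \<open>'v\<close> is the universe from which the vertices of the polyhedron are
  taken.\<close>

definition hpol :: "'v itself \<Rightarrow> 'p ptd \<Rightarrow> bool" where
  "hpol V P \<longleftrightarrow> ptd_space P \<and>
     (\<exists>(K :: 'v set set) v. abstract_simplicial_complex K \<and> ptd_space (polyhedron K, v) \<and>
        (\<exists>f \<in> hhom P (polyhedron K, v). \<exists>g \<in> hhom (polyhedron K, v) P.
           hcomp P P g f = hid P \<and>
           hcomp (polyhedron K, v) (polyhedron K, v) f g = hid (polyhedron K, v)))"


section \<open>Inverse systems and expansions\<close>

definition directed :: "'i set \<Rightarrow> ('i \<Rightarrow> 'i \<Rightarrow> bool) \<Rightarrow> bool" where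
  "directed \<Lambda> le \<longleftrightarrow> \<Lambda> \<noteq> {} \<and> (\<forall>i\<in>\<Lambda>. le i i) \<and>
     (\<forall>i\<in>\<Lambda>. \<forall>j\<in>\<Lambda>. \<forall>k\<in>\<Lambda>. le i j \<and> le j k \<longrightarrow> le i k) \<and>
     (\<forall>i\<in>\<Lambda>. \<forall>j\<in>\<Lambda>. \<exists>k\<in>\<Lambda>. le i k \<and> le j k)"

text \<open>The bonding morphism \<open>p i j\<close> goes from \<open>XX j\<close> to \<open>XX i\<close>, for \<open>i \<le> j\<close>.\<close>

definition hpol_inverse_system ::
  "'v itself \<Rightarrow> 'i set \<Rightarrow> ('i \<Rightarrow> 'i \<Rightarrow> bool) \<Rightarrow> ('i \<Rightarrow> 'b ptd) \<Rightarrow> ('i \<Rightarrow> 'i \<Rightarrow> ('b \<Rightarrow> 'b) set) \<Rightarrow> bool"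
where
  "hpol_inverse_system V \<Lambda> le XX p \<longleftrightarrow> directed \<Lambda> le \<and>
     (\<forall>i\<in>\<Lambda>. hpol V (XX i)) \<and>
     (\<forall>i\<in>\<Lambda>. \<forall>j\<in>\<Lambda>. le i j \<longrightarrow> p i j \<in> hhom (XX j) (XX i)) \<and>
     (\<forall>i\<in>\<Lambda>. p i i = hid (XX i)) \<and>
     (\<forall>i\<in>\<Lambda>. \<forall>j\<in>\<Lambda>. \<forall>k\<in>\<Lambda>. le i j \<and> le j k \<longrightarrow> hcomp (XX k) (XX i) (p i j) (p j k) = p i k)"

text \<open>Both conditions (E1) and (E2) quantify over all objects of \<open>HPol\<^sub>*\<close>. As HOL does not quantify
  over types inside a formula, the test spaces range over the pointed spaces with points in the type
  \<open>'p\<close> that are pointed homotopy equivalent to a polyhedron with vertices in the type \<open>'v\<close>.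
  No closure property of these universes is assumed. A map into a polyhedron, or a
  homotopy of such maps, has its image in a subcomplex with at most as many vertices as its domain
  has points (or countably many), so the test spaces suffice for the unrestricted conditions as soon
  as \<open>'v\<close> is infinite and at least as large as the spaces involved and \<open>'p\<close> is \<open>'v \<Rightarrow> real\<close>. For
  smaller universes, the conditions below are weaker than the unrestricted ones.\<close>

definition hpol_expansion ::
  "'v itself \<Rightarrow> 'p itself \<Rightarrow> 'a ptd \<Rightarrow> 'i set \<Rightarrow> ('i \<Rightarrow> 'i \<Rightarrow> bool) \<Rightarrow> ('i \<Rightarrow> 'b ptd) \<Rightarrow>
     ('i \<Rightarrow> 'i \<Rightarrow> ('b \<Rightarrow> 'b) set) \<Rightarrow> ('i \<Rightarrow> ('a \<Rightarrow> 'b) set) \<Rightarrow> bool"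
where
  "hpol_expansion V W X \<Lambda> le XX p pr \<longleftrightarrow>
     hpol_inverse_system V \<Lambda> le XX p \<and>
     (\<forall>i\<in>\<Lambda>. pr i \<in> hhom X (XX i)) \<and>
     (\<forall>i\<in>\<Lambda>. \<forall>j\<in>\<Lambda>. le i j \<longrightarrow> hcomp X (XX i) (p i j) (pr j) = pr i) \<and>
     (\<forall>P :: 'p ptd. hpol V P \<longrightarrow>
        (\<forall>h \<in> hhom X P. \<exists>i\<in>\<Lambda>. \<exists>f \<in> hhom (XX i) P. hcomp X P f (pr i) = h)) \<and>
     (\<forall>P :: 'p ptd. hpol V P \<longrightarrow>
        (\<forall>i\<in>\<Lambda>. \<forall>f0 \<in> hhom (XX i) P. \<forall>f1 \<in> hhom (XX i) P.
           hcomp X P f0 (pr i) = hcomp X P f1 (pr i) \<longrightarrow>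
           (\<exists>j\<in>\<Lambda>. le i j \<and> hcomp (XX j) P f0 (p i j) = hcomp (XX j) P f1 (p i j))))"


section \<open>Shape groups and shape loop spaces\<close>

definition ptd_sphere :: "nat \<Rightarrow> (nat \<Rightarrow> real) ptd" where
  "ptd_sphere k = (nsphere k, \<lambda>i. if i = 0 then 1 else 0)"

lemma ptd_space_sphere: "ptd_space (ptd_sphere k)"
proof -
  have "(\<Sum>i\<le>k. (if i = 0 then 1 else 0 :: real)\<^sup>2) = (\<Sum>i\<le>k. if i = 0 then 1 else 0)"
    by (rule sum.cong) auto
  then show ?thesis
    by (simp add: ptd_space_def ptd_sphere_def nsphere)
qed

definition loops :: "nat \<Rightarrow> 'b ptd \<Rightarrow> ((nat \<Rightarrow> real) \<Rightarrow> 'b) set" where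
  "loops k Y = {a \<in> extensional (topspace (nsphere k)). ptd_map (ptd_sphere k) Y a}"

text \<open>The compact-open topology.\<close>

definition loop_space :: "nat \<Rightarrow> 'b ptd \<Rightarrow> ((nat \<Rightarrow> real) \<Rightarrow> 'b) topology" where
  "loop_space k Y = topology_generated_by
     {{a \<in> loops k Y. a ` C \<subseteq> U} | C U. compactin (nsphere k) C \<and> openin (fst Y) U}"

lemma topspace_loop_space: "topspace (loop_space k Y) = loops k Y"
proof -
  have "\<exists>C U. loops k Y = {a \<in> loops k Y. a ` C \<subseteq> U} \<and> compactin (nsphere k) C \<and> openin (fst Y) U"
    by (rule exI[of _ "{}"], rule exI[of _ "{}"]) auto
  then show ?thesis
    unfolding loop_space_def topology_generated_by_topspace by blast
qed

definition shape_loops ::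
  "nat \<Rightarrow> 'i set \<Rightarrow> ('i \<Rightarrow> 'i \<Rightarrow> bool) \<Rightarrow> ('i \<Rightarrow> 'b ptd) \<Rightarrow> ('i \<Rightarrow> 'i \<Rightarrow> ('b \<Rightarrow> 'b) set) \<Rightarrow>
     ('i \<Rightarrow> (nat \<Rightarrow> real) \<Rightarrow> 'b) set"
where
  "shape_loops k \<Lambda> le XX p = {a \<in> Pi\<^sub>E \<Lambda> (\<lambda>i. loops k (XX i)).
     \<forall>i\<in>\<Lambda>. \<forall>j\<in>\<Lambda>. le i j \<longrightarrow>
       hcomp (ptd_sphere k) (XX i) (p i j) (hclass (ptd_sphere k) (XX j) (a j))
         = hclass (ptd_sphere k) (XX i) (a i)}"

definition shape_loop_space ::
  "nat \<Rightarrow> 'i set \<Rightarrow> ('i \<Rightarrow> 'i \<Rightarrow> bool) \<Rightarrow> ('i \<Rightarrow> 'b ptd) \<Rightarrow> ('i \<Rightarrow> 'i \<Rightarrow> ('b \<Rightarrow> 'b) set) \<Rightarrow>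
     ('i \<Rightarrow> (nat \<Rightarrow> real) \<Rightarrow> 'b) topology"
where
  "shape_loop_space k \<Lambda> le XX p =
     subtopology (product_topology (\<lambda>i. loop_space k (XX i)) \<Lambda>) (shape_loops k \<Lambda> le XX p)"

text \<open>The underlying set of the \<open>k\<close>th shape group, computed from the given expansion.\<close>

definition shape_morphisms ::
  "nat \<Rightarrow> 'i set \<Rightarrow> ('i \<Rightarrow> 'i \<Rightarrow> bool) \<Rightarrow> ('i \<Rightarrow> 'b ptd) \<Rightarrow> ('i \<Rightarrow> 'i \<Rightarrow> ('b \<Rightarrow> 'b) set) \<Rightarrow>
     ('i \<Rightarrow> ((nat \<Rightarrow> real) \<Rightarrow> 'b) set) set"
where
  "shape_morphisms k \<Lambda> le XX p = {F \<in> Pi\<^sub>E \<Lambda> (\<lambda>i. hhom (ptd_sphere k) (XX i)).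
     \<forall>i\<in>\<Lambda>. \<forall>j\<in>\<Lambda>. le i j \<longrightarrow> hcomp (ptd_sphere k) (XX i) (p i j) (F j) = F i}"

definition shape_basic ::
  "nat \<Rightarrow> 'i set \<Rightarrow> ('i \<Rightarrow> 'i \<Rightarrow> bool) \<Rightarrow> ('i \<Rightarrow> 'b ptd) \<Rightarrow> ('i \<Rightarrow> 'i \<Rightarrow> ('b \<Rightarrow> 'b) set) \<Rightarrow>
     'i \<Rightarrow> ('i \<Rightarrow> ((nat \<Rightarrow> real) \<Rightarrow> 'b) set) \<Rightarrow> ('i \<Rightarrow> ((nat \<Rightarrow> real) \<Rightarrow> 'b) set) set"
where
  "shape_basic k \<Lambda> le XX p i F = {G \<in> shape_morphisms k \<Lambda> le XX p. F i = G i}"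

definition shape_group_top ::
  "nat \<Rightarrow> 'i set \<Rightarrow> ('i \<Rightarrow> 'i \<Rightarrow> bool) \<Rightarrow> ('i \<Rightarrow> 'b ptd) \<Rightarrow> ('i \<Rightarrow> 'i \<Rightarrow> ('b \<Rightarrow> 'b) set) \<Rightarrow>
     ('i \<Rightarrow> ((nat \<Rightarrow> real) \<Rightarrow> 'b) set) topology"
where
  "shape_group_top k \<Lambda> le XX p = topology (arbitrary union_of
     (\<lambda>V. \<exists>i\<in>\<Lambda>. \<exists>F \<in> shape_morphisms k \<Lambda> le XX p. V = shape_basic k \<Lambda> le XX p i F))"

definition shape_loop_class ::
  "nat \<Rightarrow> 'i set \<Rightarrow> ('i \<Rightarrow> 'b ptd) \<Rightarrow> ('i \<Rightarrow> (nat \<Rightarrow> real) \<Rightarrow> 'b) \<Rightarrow>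
     ('i \<Rightarrow> ((nat \<Rightarrow> real) \<Rightarrow> 'b) set)"
where
  "shape_loop_class k \<Lambda> XX a = (\<lambda>i\<in>\<Lambda>. hclass (ptd_sphere k) (XX i) (a i))"

lemma openin_shape_group_top:
  assumes "directed \<Lambda> le"
  shows "openin (shape_group_top k \<Lambda> le XX p) U \<longleftrightarrow>
    U \<subseteq> shape_morphisms k \<Lambda> le XX p \<and> (\<forall>F\<in>U. \<exists>i\<in>\<Lambda>. shape_basic k \<Lambda> le XX p i F \<subseteq> U)"
proof -
  let ?M = "shape_morphisms k \<Lambda> le XX p"
  let ?V = "shape_basic k \<Lambda> le XX p"
  let ?B = "\<lambda>V. \<exists>i\<in>\<Lambda>. \<exists>F \<in> ?M. V = ?V i F"
  have mono: "?V j G \<subseteq> ?V i G" if "G \<in> ?M" "i \<in> \<Lambda>" "j \<in> \<Lambda>" "le i j" for i j G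
  proof
    fix H assume "H \<in> ?V j G"
    then have H: "H \<in> ?M" "G j = H j" by (simp_all add: shape_basic_def)
    let ?c = "hcomp (ptd_sphere k) (XX i) (p i j)"
    have "?c (G j) = G i" "?c (H j) = H i"
      using that H(1) unfolding shape_morphisms_def by blast+
    then have "G i = H i" using H(2) by metis
    then show "H \<in> ?V i G" using H(1) by (simp add: shape_basic_def)
  qed
  have char: "(arbitrary union_of ?B) U \<longleftrightarrow> U \<subseteq> ?M \<and> (\<forall>F\<in>U. \<exists>i\<in>\<Lambda>. ?V i F \<subseteq> U)" for U
  proof
    assume "(arbitrary union_of ?B) U"
    then obtain \<U> where \<U>: "\<forall>V\<in>\<U>. ?B V" "U = \<Union>\<U>"
      by (auto simp: union_of_def arbitrary_def)
    have "\<exists>i\<in>\<Lambda>. ?V i G \<subseteq> U" if G: "G \<in> U" for G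
    proof -
      obtain V where V: "V \<in> \<U>" "G \<in> V"
        using G \<U>(2) by (auto simp only: Union_iff)
      then obtain i F where i: "i \<in> \<Lambda>" and VF: "V = ?V i F"
        using \<U>(1) by meson
      have "F i = G i"
        using V(2) VF by (simp add: shape_basic_def)
      then have "?V i G = V"
        unfolding VF by (simp add: shape_basic_def)
      moreover have "V \<subseteq> U"
        unfolding \<U>(2) using V(1) by (rule Union_upper)
      ultimately show ?thesis
        using i by (intro bexI[of _ i]) simp_all
    qed
    moreover have "V \<subseteq> ?M" if "V \<in> \<U>" for V
      using \<U>(1) that unfolding shape_basic_def by (metis (no_types, lifting) mem_Collect_eq subsetI)
    then have "U \<subseteq> ?M"
      unfolding \<U>(2) by (rule Union_least)
    ultimately show "U \<subseteq> ?M \<and> (\<forall>F\<in>U. \<exists>i\<in>\<Lambda>. ?V i F \<subseteq> U)" by blast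
  next
    assume U: "U \<subseteq> ?M \<and> (\<forall>F\<in>U. \<exists>i\<in>\<Lambda>. ?V i F \<subseteq> U)"
    let ?W = "{V. ?B V \<and> V \<subseteq> U}"
    have "F \<in> \<Union>?W" if F: "F \<in> U" for F
    proof -
      obtain i where i: "i \<in> \<Lambda>" "?V i F \<subseteq> U" using U F by meson
      have "F \<in> ?M" using U F by (meson subsetD)
      with i have "?V i F \<in> ?W" "F \<in> ?V i F"
        by (auto simp only: mem_Collect_eq shape_basic_def)
      then show ?thesis by (rule UnionI)
    qed
    then have "\<Union>?W = U"
      by (intro equalityI subsetI) (auto simp only: Union_iff mem_Collect_eq subset_iff)
    then show "(arbitrary union_of ?B) U"
      unfolding union_of_def arbitrary_def by (intro exI[of _ ?W] conjI) (simp_all add: Collect_mono)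
  qed
  have "istopology (arbitrary union_of ?B)"
    unfolding istopology_base_alt char
  proof (intro allI impI conjI ballI)
    fix S T F
    assume ST: "(S \<subseteq> ?M \<and> (\<forall>F\<in>S. \<exists>i\<in>\<Lambda>. ?V i F \<subseteq> S)) \<and> T \<subseteq> ?M \<and> (\<forall>F\<in>T. \<exists>i\<in>\<Lambda>. ?V i F \<subseteq> T)"
    show "S \<inter> T \<subseteq> ?M" using ST by blast
    assume F: "F \<in> S \<inter> T"
    then obtain i j where ij: "i \<in> \<Lambda>" "j \<in> \<Lambda>" "?V i F \<subseteq> S" "?V j F \<subseteq> T"
      using ST by blast
    then obtain l where "l \<in> \<Lambda>" "le i l" "le j l"
      using assms unfolding directed_def by blast
    moreover have "F \<in> ?M" using F ST by blast
    ultimately show "\<exists>i\<in>\<Lambda>. ?V i F \<subseteq> S \<inter> T"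
      using ij mono by (meson Int_greatest subset_trans)
  qed
  then show ?thesis
    by (simp add: shape_group_top_def topology_inverse' char)
qed

lemma topspace_shape_group_top:
  assumes "directed \<Lambda> le"
  shows "topspace (shape_group_top k \<Lambda> le XX p) = shape_morphisms k \<Lambda> le XX p"
proof
  show "topspace (shape_group_top k \<Lambda> le XX p) \<subseteq> shape_morphisms k \<Lambda> le XX p"
    using openin_shape_group_top[OF assms] openin_topspace by blast
  have "openin (shape_group_top k \<Lambda> le XX p) (shape_morphisms k \<Lambda> le XX p)"
    using assms unfolding openin_shape_group_top[OF assms] directed_def shape_basic_def by blast
  then show "shape_morphisms k \<Lambda> le XX p \<subseteq> topspace (shape_group_top k \<Lambda> le XX p)"
    by (rule openin_subset)
qed

lemma topspace_shape_loop_space: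
  "topspace (shape_loop_space k \<Lambda> le XX p) = shape_loops k \<Lambda> le XX p"
  by (auto simp: shape_loop_space_def topspace_loop_space shape_loops_def)

end

theory Submission
  imports Defs
begin

text \<open>In a polyhedron, two maps of a compact space whose carriers share a vertex at every point
  are homotopic. For a loop \<open>a\<close>, the loops whose carriers meet those of \<open>a\<close> everywhere form a
  neighbourhood of \<open>a\<close> in the compact-open topology, because the sphere is compact and open stars are
  open. Hence homotopy classes are open in the loop space of a polyhedron, and also in that of any
  space it dominates, which makes \<open>q\<close> continuous. Conversely, an open neighbourhood of a
  shape loop \<open>a\<close> restricts only finitely many coordinates. If \<open>j\<close> lies above all of these, then every
  shape morphism that agrees with \<open>q a\<close> at \<open>j\<close> has a representative that equals \<open>a\<close> in the
  restricted coordinates, so it lies in the image of the neighbourhood.\<close>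

section \<open>Closed simplices and the weak topology\<close>

lemma abstract_simplicial_complex_face:
  assumes "abstract_simplicial_complex K" "\<sigma> \<in> K" "\<tau> \<subseteq> \<sigma>" "\<tau> \<noteq> {}"
  shows "\<tau> \<in> K"
  using assms unfolding abstract_simplicial_complex_def by meson

lemma closed_simplex_positive_coordinate:
  assumes "x \<in> closed_simplex \<sigma>"
  shows "\<exists>v\<in>\<sigma>. 0 < x v"
proof (rule ccontr)
  assume "\<not> ?thesis"
  then have "sum x \<sigma> \<le> 0" by (intro sum_nonpos) (auto simp: not_less)
  with assms show False by (simp add: closed_simplex_def)
qed

text \<open>Coordinates outside \<open>V\<close> contribute nothing to the sum 1, so
  \<open>\<sigma> \<inter> V\<close> carries all of it; in particular this face is nonempty. With
  \<open>V\<close> finite, the lemma moves points into a finite subcomplex.\<close>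

lemma closed_simplex_restrict:
  assumes K: "abstract_simplicial_complex K" and "\<sigma> \<in> K" and x: "x \<in> closed_simplex \<sigma>"
    and V: "\<And>v. v \<notin> V \<Longrightarrow> x v = 0"
  shows "\<sigma> \<inter> V \<in> K" "x \<in> closed_simplex (\<sigma> \<inter> V)"
proof -
  have "\<sigma> \<inter> V \<noteq> {}"
    using closed_simplex_positive_coordinate[OF x] V by fastforce
  then show "\<sigma> \<inter> V \<in> K"
    by (intro abstract_simplicial_complex_face[OF K \<open>\<sigma> \<in> K\<close>]) simp_all
  have "finite \<sigma>" using K \<open>\<sigma> \<in> K\<close> unfolding abstract_simplicial_complex_def by blast
  then have "sum x (\<sigma> \<inter> V) = sum x \<sigma>"
    using V by (intro sum.mono_neutral_left) auto
  then show "x \<in> closed_simplex (\<sigma> \<inter> V)"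
    using x V by (auto simp: closed_simplex_def)
qed

lemma closed_closed_simplex:
  "finite \<sigma> \<Longrightarrow> closed (closed_simplex \<sigma> :: ('v \<Rightarrow> real) set)"
proof -
  assume "finite \<sigma>"
  have eq: "closed_simplex \<sigma> = (\<Inter>v. {t. 0 \<le> t v}) \<inter> (\<Inter>v\<in>-\<sigma>. {t. t v = 0}) \<inter> {t. sum t \<sigma> = (1::real)}"
    by (auto simp: closed_simplex_def)
  have "continuous_on UNIV (\<lambda>t :: 'v \<Rightarrow> real. t v)" for v
    by (simp add: continuous_on_product_coordinates)
  then show ?thesis
    unfolding eq
    by (intro closed_Int closed_INT ballI closed_Collect_le closed_Collect_eq continuous_on_sum
        continuous_on_const)
qed

lemma closedin_polyhedron:
  assumes "C \<subseteq> topspace (polyhedron K)"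
  shows "closedin (polyhedron K) C \<longleftrightarrow>
    (\<forall>\<sigma>\<in>K. closedin (top_of_set (closed_simplex \<sigma>)) (C \<inter> closed_simplex \<sigma>))"
proof -
  have "(topspace (polyhedron K) - C) \<inter> closed_simplex \<sigma> = closed_simplex \<sigma> - C \<inter> closed_simplex \<sigma>"
    if "\<sigma> \<in> K" for \<sigma>
    using that by (auto simp: topspace_polyhedron)
  moreover have "topspace (polyhedron K) - C \<subseteq> (\<Union>\<sigma>\<in>K. closed_simplex \<sigma>)"
    by (auto simp: topspace_polyhedron)
  ultimately show ?thesis
    using assms by (simp add: closedin_def openin_polyhedron)
qed

text \<open>Weak openness is tested on one closed simplex at a time, where the evaluation at
  \<open>v\<close> is continuous. In particular, the open star \<open>{x. 0 < x v}\<close> of a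
  vertex is open.\<close>

lemma continuous_map_polyhedron_coordinate:
  "continuous_map (polyhedron K) euclideanreal (\<lambda>x. x v)"
proof -
  have "openin (polyhedron K) {x \<in> topspace (polyhedron K). x v \<in> U}" if "open U" for U
  proof -
    have "openin (top_of_set (closed_simplex \<sigma>))
        ({x \<in> topspace (polyhedron K). x v \<in> U} \<inter> closed_simplex \<sigma>)" if "\<sigma> \<in> K" for \<sigma>
    proof -
      have "{x \<in> topspace (polyhedron K). x v \<in> U} \<inter> closed_simplex \<sigma> =
          closed_simplex \<sigma> \<inter> (\<lambda>x. x v) -` U"
        using that by (auto simp: topspace_polyhedron)
      moreover have "open ((\<lambda>x :: 'a \<Rightarrow> real. x v) -` U)"
        using \<open>open U\<close> by (intro open_vimage continuous_on_product_coordinates)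
      ultimately show ?thesis
        by (simp add: openin_open_Int)
    qed
    then show ?thesis
      by (auto simp: openin_polyhedron topspace_polyhedron)
  qed
  then show ?thesis
    by (auto simp: continuous_map)
qed

section \<open>Compactness and finite subcomplexes\<close>

lemma finite_imp_closed_fun:
  fixes S :: "('a \<Rightarrow> 'b::t2_space) set"
  assumes "finite S"
  shows "closed S"
proof -
  have "closed {x}" for x :: "'a \<Rightarrow> 'b"
  proof -
    have "{x} = (\<Inter>v. {t. t v = x v})" by auto
    then show ?thesis
      by (simp add: closed_INT closed_Collect_eq continuous_on_product_coordinates)
  qed
  then have "closed (\<Union>x\<in>S. {x})"
    using assms by (intro closed_UN) auto
  then show ?thesis by simp
qed

text \<open>A set with one point of \<open>C\<close> per support meets every closed simplex in a
  finite set, so all of its subsets are closed. Being closed and discrete inside a compact set it is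
  finite, and each support is finite.\<close>

lemma compactin_polyhedron_finite_vertices:
  assumes K: "abstract_simplicial_complex K" and C: "compactin (polyhedron K) C"
  shows "\<exists>V. finite V \<and> (\<forall>x\<in>C. \<forall>v. v \<notin> V \<longrightarrow> x v = 0)"
proof -
  define supp where "supp x = {v. x v \<noteq> (0::real)}" for x :: "'a \<Rightarrow> real"
  have sub: "C \<subseteq> topspace (polyhedron K)"
    using C by (rule compactin_subset_topspace)
  \<comment> \<open>\<open>D\<close> contains exactly one point of \<open>C\<close> for each support
    that occurs in \<open>C\<close>.\<close>
  from iffD1[OF subset_image_inj order_refl[of "supp ` C"]]
  obtain D where D: "D \<subseteq> C" "inj_on supp D" "supp ` C = supp ` D"
    by (elim exE conjE)
  have supp_sub: "supp x \<subseteq> \<sigma>" if "x \<in> closed_simplex \<sigma>" for x \<sigma>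
    using that by (auto simp: closed_simplex_def supp_def)
  have closed: "closedin (polyhedron K) E" if "E \<subseteq> D" for E
  proof -
    \<comment> \<open>Points of a closed simplex have their supports among the finitely many subsets
      of \<open>\<sigma>\<close>, and points of \<open>D\<close> are determined by their
      supports.\<close>
    have "finite (E \<inter> closed_simplex \<sigma>)" if "\<sigma> \<in> K" for \<sigma>
    proof -
      have "finite \<sigma>" using K that unfolding abstract_simplicial_complex_def by blast
      then have "finite (supp ` (E \<inter> closed_simplex \<sigma>))"
        by (rule finite_subset[rotated, OF finite_Pow_iff[THEN iffD2]]) (use supp_sub in blast)
      moreover have "inj_on supp (E \<inter> closed_simplex \<sigma>)"
        using D(2) \<open>E \<subseteq> D\<close> by (meson inf.coboundedI1 inj_on_subset)
      ultimately show ?thesis by (rule finite_imageD)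
    qed
    moreover have "E \<subseteq> topspace (polyhedron K)" using that D(1) sub by blast
    ultimately show ?thesis
      by (auto simp: closedin_polyhedron intro!: closed_subset finite_imp_closed_fun)
  qed
  \<comment> \<open>The open set \<open>?U d\<close> contains no point of \<open>D\<close> other
    than \<open>d\<close>, so a finite subcover of \<open>C\<close> uses every index in
    \<open>D\<close>.\<close>
  let ?U = "\<lambda>d. topspace (polyhedron K) - (D - {d})"
  have "finite D"
  proof (cases "D = {}")
    case False
    have "C \<subseteq> \<Union>(?U ` D)" using sub False by blast
    moreover have "openin (polyhedron K) (?U d)" for d
      by (intro openin_diff openin_topspace closed) blast
    ultimately obtain \<F> where \<F>: "finite \<F>" "\<F> \<subseteq> ?U ` D" "C \<subseteq> \<Union>\<F>"
      using C unfolding compactin_def by (metis (no_types, lifting) imageE)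
    then obtain D' where D': "finite D'" "D' \<subseteq> D" "\<F> = ?U ` D'"
      by (meson finite_subset_image)
    then have "D \<subseteq> D'" using \<F>(3) D(1) by blast
    then show ?thesis using D'(1) finite_subset by blast
  qed simp
  moreover have "finite (supp d)" if d: "d \<in> D" for d
  proof -
    obtain \<sigma> where "\<sigma> \<in> K" "d \<in> closed_simplex \<sigma>"
      using d D(1) sub unfolding topspace_polyhedron by blast
    then show ?thesis
      using supp_sub K unfolding abstract_simplicial_complex_def by (meson finite_subset)
  qed
  ultimately have "finite (\<Union>(supp ` C))"
    by (simp add: D(3))
  then show ?thesis
    by (intro exI[of _ "\<Union>(supp ` C)"]) (auto simp: supp_def)
qed

text \<open>On a finite subcomplex the weak topology is the topology of coordinatewise convergence.\<close>

lemma continuous_map_into_polyhedron: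
  assumes K: "abstract_simplicial_complex K" and V: "finite V"
    and supp: "\<And>z v. z \<in> topspace Z \<Longrightarrow> v \<notin> V \<Longrightarrow> h z v = 0"
    and cont: "\<And>v. v \<in> V \<Longrightarrow> continuous_map Z euclideanreal (\<lambda>z. h z v)"
    and h: "\<And>z. z \<in> topspace Z \<Longrightarrow> h z \<in> topspace (polyhedron K)"
  shows "continuous_map Z (polyhedron K) h"
proof -
  let ?L = "{\<tau> \<in> K. \<tau> \<subseteq> V}"
  have "finite ?L" using V by simp
  have L: "\<exists>\<tau>\<in>?L. h z \<in> closed_simplex \<tau>" if z: "z \<in> topspace Z" for z
  proof -
    obtain \<sigma> where \<sigma>: "\<sigma> \<in> K" "h z \<in> closed_simplex \<sigma>"
      using h[OF z] by (auto simp: topspace_polyhedron)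
    have "\<sigma> \<inter> V \<in> K" "h z \<in> closed_simplex (\<sigma> \<inter> V)"
      using closed_simplex_restrict[OF K \<sigma>, of V] supp[OF z] by simp_all
    then show ?thesis
      by (intro bexI[of _ "\<sigma> \<inter> V"]) simp_all
  qed
  have "continuous_map Z euclideanreal (\<lambda>z. h z v)" for v
  proof (cases "v \<in> V")
    case False
    then show ?thesis
      using continuous_map_eq[of Z euclideanreal "\<lambda>_. 0" "\<lambda>z. h z v"] supp by auto
  qed (rule cont)
  then have conth: "continuous_map Z euclidean h"
    by (simp add: continuous_map_componentwise_UNIV flip: euclidean_product_topology)
  \<comment> \<open>Only the finitely many simplices in \<open>?L\<close> are met by the image of
    \<open>h\<close>. The part of \<open>C\<close> in each of them is closed for coordinatewise
    convergence, hence so is their finite union.\<close>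
  have "closedin Z {z \<in> topspace Z. h z \<in> C}" if C: "closedin (polyhedron K) C" for C
  proof -
    have "closed (C \<inter> closed_simplex \<tau>)" if "\<tau> \<in> K" for \<tau>
    proof -
      have "finite \<tau>" using that K by (auto simp: abstract_simplicial_complex_def)
      moreover have "closedin (top_of_set (closed_simplex \<tau>)) (C \<inter> closed_simplex \<tau>)"
        using C that closedin_polyhedron closedin_subset by blast
      ultimately show ?thesis
        using closed_closed_simplex closedin_closed_trans by blast
    qed
    then have "closed (\<Union>\<tau>\<in>?L. C \<inter> closed_simplex \<tau>)"
      using \<open>finite ?L\<close> by (intro closed_UN) auto
    then have "closedin Z {z \<in> topspace Z. h z \<in> (\<Union>\<tau>\<in>?L. C \<inter> closed_simplex \<tau>)}"
      using conth by (auto simp: continuous_map_closedin)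
    moreover have "{z \<in> topspace Z. h z \<in> (\<Union>\<tau>\<in>?L. C \<inter> closed_simplex \<tau>)} = {z \<in> topspace Z. h z \<in> C}"
      using L by blast
    ultimately show ?thesis by simp
  qed
  then show ?thesis
    using h by (auto simp: continuous_map_closedin)
qed

section \<open>Homotopies in polyhedra\<close>

lemma convex_closed_simplex:
  assumes "x \<in> closed_simplex \<sigma>" "y \<in> closed_simplex \<sigma>" "0 \<le> t" "t \<le> 1"
  shows "(\<lambda>v. (1 - t) * x v + t * y v) \<in> closed_simplex \<sigma>"
  using assms unfolding closed_simplex_def mem_Collect_eq
  by (simp add: sum.distrib flip: sum_distrib_left)

lemma continuous_map_polyhedron_finite_vertices:
  assumes "abstract_simplicial_complex K" "compact_space T" "continuous_map T (polyhedron K) f"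
  shows "\<exists>V. finite V \<and> (\<forall>s\<in>topspace T. \<forall>v. v \<notin> V \<longrightarrow> f s v = 0)"
proof -
  have "compactin (polyhedron K) (f ` topspace T)"
    using assms(2,3) image_compactin unfolding compact_space_def by blast
  from compactin_polyhedron_finite_vertices[OF assms(1) this] show ?thesis
    by simp
qed

text \<open>The straight-line homotopy stays in the common simplices by convexity. Compactness of
  \<open>T\<close> confines it to finitely many vertices, where continuity of the coordinates
  suffices. It is stationary wherever \<open>f\<close> and \<open>g\<close> agree, which later
  yields pointed homotopies.\<close>

lemma homotopic_with_polyhedron_linear:
  assumes K: "abstract_simplicial_complex K" and T: "compact_space T"
    and f: "continuous_map T (polyhedron K) f" and g: "continuous_map T (polyhedron K) g"
    and fg: "\<And>s. s \<in> topspace T \<Longrightarrow> \<exists>\<sigma>\<in>K. f s \<in> closed_simplex \<sigma> \<and> g s \<in> closed_simplex \<sigma>"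
  shows "homotopic_with (\<lambda>h. \<forall>s. f s = g s \<longrightarrow> h s = f s) T (polyhedron K) f g"
proof -
  obtain V W where VW: "finite V" "\<And>s v. s \<in> topspace T \<Longrightarrow> v \<notin> V \<Longrightarrow> f s v = 0"
    "finite W" "\<And>s v. s \<in> topspace T \<Longrightarrow> v \<notin> W \<Longrightarrow> g s v = 0"
    using continuous_map_polyhedron_finite_vertices[OF K T] f g by metis
  let ?I = "prod_topology (top_of_set {0..1::real}) T"
  let ?h = "\<lambda>z v. (1 - fst z) * f (snd z) v + fst z * g (snd z) v"
  have snd: "continuous_map ?I T snd" and fst: "continuous_map ?I euclideanreal fst"
    using continuous_map_fst[of "top_of_set {0..1::real}" T]
    by (auto simp: continuous_map_snd continuous_map_in_subtopology)
  have coord: "continuous_map ?I euclideanreal (\<lambda>z. u (snd z) v)"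
    if "continuous_map T (polyhedron K) u" for u v
    using continuous_map_compose[OF continuous_map_compose[OF snd that]
        continuous_map_polyhedron_coordinate] by (simp add: o_def)
  have "continuous_map ?I (polyhedron K) ?h"
  proof (rule continuous_map_into_polyhedron[OF K, of "V \<union> W"])
    show "continuous_map ?I euclideanreal (\<lambda>z. ?h z v)" for v
      by (intro continuous_intros coord fst f g) simp_all
    show "?h z \<in> topspace (polyhedron K)" if "z \<in> topspace ?I" for z
    proof -
      from that have "snd z \<in> topspace T" and t: "0 \<le> fst z" "fst z \<le> 1" by auto
      then obtain \<sigma> where \<sigma>: "\<sigma> \<in> K" "f (snd z) \<in> closed_simplex \<sigma>" "g (snd z) \<in> closed_simplex \<sigma>"
        using fg by blast
      then show ?thesis
        using convex_closed_simplex[OF \<sigma>(2,3) t] by (auto simp: topspace_polyhedron)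
    qed
  qed (use VW in auto)
  then show ?thesis
    unfolding homotopic_with_def by (intro exI[of _ ?h]) (auto simp: algebra_simps)
qed

text \<open>The homotopy runs linearly from \<open>f s\<close> to the normalized minimum of \<open>f s\<close> and \<open>g s\<close>, which
  lies in the face spanned by the common vertices of their carriers, and then linearly to \<open>g s\<close>.\<close>

lemma homotopic_with_polyhedron_contiguous:
  assumes K: "abstract_simplicial_complex K" and T: "compact_space T"
    and f: "continuous_map T (polyhedron K) f" and g: "continuous_map T (polyhedron K) g"
    and fg: "\<And>s. s \<in> topspace T \<Longrightarrow> \<exists>v. 0 < f s v \<and> 0 < g s v"
    and s0: "s0 \<in> topspace T" "f s0 = g s0"
  shows "homotopic_with (\<lambda>h. h s0 = f s0) T (polyhedron K) f g"
proof -
  \<comment> \<open>The vertices used by \<open>f\<close> suffice to normalize the minimum: the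
    coordinates of \<open>g\<close> are nonnegative, so the minimum vanishes wherever
    \<open>f\<close> does.\<close>
  obtain V where V: "finite V" "\<And>s v. s \<in> topspace T \<Longrightarrow> v \<notin> V \<Longrightarrow> f s v = 0"
    using continuous_map_polyhedron_finite_vertices[OF K T f] by metis
  let ?\<mu> = "\<lambda>s v. min (f s v) (g s v)"
  let ?m = "\<lambda>s v. ?\<mu> s v / (\<Sum>w\<in>V. ?\<mu> s w)"
  have nonneg: "0 \<le> u s v" if "s \<in> topspace T" "continuous_map T (polyhedron K) u" for u s v
    using that continuous_map_image_subset_topspace[OF that(2)]
    by (auto simp: topspace_polyhedron closed_simplex_def)
  \<comment> \<open>The common vertex from \<open>fg\<close> keeps the normalizing denominator away
    from zero.\<close>
  have pos: "0 < (\<Sum>w\<in>V. ?\<mu> s w)" if s: "s \<in> topspace T" for s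
  proof -
    obtain v where v: "0 < f s v" "0 < g s v" using fg s by blast
    then have "v \<in> V" using V(2)[OF s] by force
    then show ?thesis
      using v V(1) nonneg[OF s f] nonneg[OF s g] by (intro sum_pos2) auto
  qed
  \<comment> \<open>The minimum vanishes wherever either map does, so its normalization lies in
    every closed simplex of \<open>K\<close> that contains \<open>f s\<close> or
    \<open>g s\<close>.\<close>
  have m_simplex: "?m s \<in> closed_simplex \<sigma>"
    if s: "s \<in> topspace T" and \<sigma>: "\<sigma> \<in> K" "f s \<in> closed_simplex \<sigma> \<or> g s \<in> closed_simplex \<sigma>" for s \<sigma>
  proof -
    have 0: "?\<mu> s v = 0" if "v \<notin> \<sigma> \<or> v \<notin> V" for v
      using that \<sigma>(2) V(2)[OF s] nonneg[OF s f, of v] nonneg[OF s g, of v]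
      by (auto simp: closed_simplex_def min_def)
    have "finite \<sigma>" using \<sigma>(1) K by (auto simp: abstract_simplicial_complex_def)
    have "sum (?\<mu> s) \<sigma> = sum (?\<mu> s) (\<sigma> \<inter> V)"
      using \<open>finite \<sigma>\<close> 0 by (intro sum.mono_neutral_right) auto
    also have "\<dots> = sum (?\<mu> s) V"
      using V(1) 0 by (intro sum.mono_neutral_left) auto
    finally have "sum (?m s) \<sigma> = 1"
      using pos[OF s] by (simp flip: sum_divide_distrib)
    then show ?thesis
      using 0 pos[OF s] nonneg[OF s f] nonneg[OF s g]
      by (auto simp: closed_simplex_def intro!: divide_nonneg_pos)
  qed
  have carrier: "\<exists>\<sigma>\<in>K. u s \<in> closed_simplex \<sigma>"
    if "s \<in> topspace T" "continuous_map T (polyhedron K) u" for u s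
    using that continuous_map_image_subset_topspace[OF that(2)]
    by (auto simp: topspace_polyhedron)
  have coord: "continuous_map T euclideanreal (\<lambda>s. u s v)"
    if "continuous_map T (polyhedron K) u" for u v
    using continuous_map_compose[OF that continuous_map_polyhedron_coordinate] by (simp add: o_def)
  have m: "continuous_map T (polyhedron K) ?m"
  proof (rule continuous_map_into_polyhedron[OF K V(1)])
    show "continuous_map T euclideanreal (\<lambda>s. ?m s v)" for v
      using pos V(1)
      by (intro continuous_map_real_divide continuous_map_sum continuous_map_real_min coord f g)
        fastforce+
    show "?m s v = 0" if "s \<in> topspace T" "v \<notin> V" for s v
      using that V(2) nonneg[OF that(1) g, of v] by (simp add: min_def)
    show "?m s \<in> topspace (polyhedron K)" if "s \<in> topspace T" for s
      using carrier[OF that f] m_simplex[OF that] by (auto simp: topspace_polyhedron)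
  qed
  \<comment> \<open>At \<open>s0\<close> the two maps agree, so the minimum is \<open>f s0\<close>
    itself, whose coordinates over \<open>V\<close> already sum to 1.\<close>
  have ms0: "?m s0 = f s0"
  proof -
    obtain \<sigma> where \<sigma>: "\<sigma> \<in> K" "f s0 \<in> closed_simplex \<sigma>" using carrier[OF s0(1) f] by blast
    have r: "f s0 \<in> closed_simplex (\<sigma> \<inter> V)"
      using closed_simplex_restrict[OF K \<sigma>, of V] V(2)[OF s0(1)] by simp
    have "sum (f s0) V = sum (f s0) (\<sigma> \<inter> V)"
      using r V(1) by (intro sum.mono_neutral_right) (auto simp: closed_simplex_def)
    also have "\<dots> = 1" using r by (simp add: closed_simplex_def)
    finally show ?thesis
      using s0(2) by simp
  qed
  have *: "homotopic_with (\<lambda>h. h s0 = f s0) T (polyhedron K) u ?m"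
    if u: "u = f \<or> u = g" for u
  proof (rule homotopic_with_mono[OF homotopic_with_polyhedron_linear[OF K T _ m]])
    show cu: "continuous_map T (polyhedron K) u" using u f g by blast
    show "\<exists>\<sigma>\<in>K. u s \<in> closed_simplex \<sigma> \<and> ?m s \<in> closed_simplex \<sigma>" if s: "s \<in> topspace T" for s
      using carrier[OF s cu] m_simplex[OF s] u by blast
    \<comment> \<open>Both \<open>f\<close> and \<open>g\<close> agree with \<open>?m\<close> at
      \<open>s0\<close>, so the stationary linear homotopy fixes the value there.\<close>
    show "h s0 = f s0" if "\<forall>s. u s = ?m s \<longrightarrow> h s = u s" for h
      using that ms0 u s0(2) by metis
  qed
  show ?thesis
    using homotopic_with_trans[OF *[of f] homotopic_with_symD[OF *[of g]]] by simp
qed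

section \<open>Open homotopy classes in loop spaces\<close>

lemma compact_space_nsphere: "compact_space (nsphere k)"
proof -
  let ?S = "{x :: nat \<Rightarrow> real. (\<Sum>i\<le>k. (x i)\<^sup>2) = 1 \<and> (\<forall>i>k. x i = 0)}"
  \<comment> \<open>This places the sphere inside a power of \<open>{-1..1}\<close>, which is
    compact by Tychonoff's theorem.\<close>
  have bound: "x i \<in> {-1..1}" if x: "x \<in> ?S" for x i
  proof (cases "i \<le> k")
    case True
    then have "(x i)\<^sup>2 \<le> (\<Sum>i\<le>k. (x i)\<^sup>2)"
      by (intro member_le_sum) auto
    then have "\<bar>x i\<bar> \<le> 1"
      using x by (simp add: abs_square_le_1)
    then show ?thesis by auto
  next
    case False
    with x show ?thesis by simp
  qed
  have eq: "?S = {x. (\<Sum>i\<le>k. (x i)\<^sup>2) = 1} \<inter> (\<Inter>i\<in>{k<..}. {x. x i = 0})"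
    by auto
  have "closed ({x :: nat \<Rightarrow> real. (\<Sum>i\<le>k. (x i)\<^sup>2) = 1} \<inter> (\<Inter>i\<in>{k<..}. {x. x i = 0}))"
    by (intro closed_Int closed_INT ballI closed_Collect_eq continuous_intros
        continuous_on_product_coordinates)
  then have "closedin (powertop_real UNIV) ?S"
    unfolding eq by (simp add: euclidean_product_topology)
  moreover have "compactin (powertop_real UNIV) (PiE UNIV (\<lambda>_ :: nat. {-1..1}))"
    by (simp add: compactin_PiE)
  moreover have "?S \<subseteq> PiE UNIV (\<lambda>_. {-1..1})"
    using bound by blast
  ultimately have "compactin (powertop_real UNIV) ?S"
    using closed_compactin by blast
  then show ?thesis
    by (simp add: nsphere compact_space_subtopology)
qed

lemma Hausdorff_space_nsphere: "Hausdorff_space (nsphere k)"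
  by (simp add: nsphere Hausdorff_space_subtopology Hausdorff_space_product_topology)

text \<open>Of the homotopy equivalence only one half is kept: \<open>Y\<close> is a homotopy
  retract of a polyhedron. This transfers homotopies from the polyhedron back to
  \<open>Y\<close>.\<close>

lemma hpol_domination:
  fixes V :: "'v itself" and Y :: "'b ptd"
  assumes "hpol V Y"
  obtains K :: "'v set set" and v \<phi> \<psi> where
    "abstract_simplicial_complex K" "ptd_map Y (polyhedron K, v) \<phi>"
    "ptd_map (polyhedron K, v) Y \<psi>" "ptd_homotopic Y Y (\<psi> \<circ> \<phi>) id"
proof -
  obtain K :: "'v set set" and v f g where K: "abstract_simplicial_complex K"
    and f: "f \<in> hhom Y (polyhedron K, v)" and g: "g \<in> hhom (polyhedron K, v) Y"
    and gf: "hcomp Y Y g f = hid Y"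
    using assms unfolding hpol_def by (elim conjE exE bexE)
  obtain \<phi> where \<phi>: "f = hclass Y (polyhedron K, v) \<phi>" "ptd_map Y (polyhedron K, v) \<phi>"
    using f by (auto simp: hhom_def)
  obtain \<psi> where \<psi>: "g = hclass (polyhedron K, v) Y \<psi>" "ptd_map (polyhedron K, v) Y \<psi>"
    using g by (auto simp: hhom_def)
  have "hclass Y Y (\<psi> \<circ> \<phi>) = hclass Y Y id"
    using gf hcomp_hclass[OF \<phi>(2) \<psi>(2)] unfolding \<phi>(1) \<psi>(1) hid_def by simp
  moreover have "ptd_map Y Y (\<psi> \<circ> \<phi>)"
    using \<phi>(2) \<psi>(2) by (auto simp: ptd_map_def intro: continuous_map_compose)
  ultimately have "ptd_homotopic Y Y (\<psi> \<circ> \<phi>) id"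
    using hclass_eq_iff by blast
  with K \<phi>(2) \<psi>(2) show ?thesis by (rule that)
qed

text \<open>Finitely many compact pieces of the sphere are each sent by \<open>a\<close> into the
  preimage of one open star. A loop \<open>b\<close> respecting the same pieces and stars shares a
  vertex with \<open>a\<close> at every point after applying \<open>\<phi>\<close>, so the
  contiguity homotopy applies; \<open>\<psi>\<close> carries it back to \<open>Y\<close>.\<close>

lemma loop_homotopy_neighbourhood:
  fixes V :: "'v itself" and Y :: "'b ptd"
  assumes Y: "hpol V Y" and a: "a \<in> loops k Y"
  shows "\<exists>W. openin (loop_space k Y) W \<and> a \<in> W \<and> (\<forall>b\<in>W. ptd_homotopic (ptd_sphere k) Y a b)"
proof -
  let ?S = "nsphere k"
  obtain K :: "'v set set" and v \<phi> \<psi> where K: "abstract_simplicial_complex K"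
    and \<phi>: "ptd_map Y (polyhedron K, v) \<phi>" and \<psi>: "ptd_map (polyhedron K, v) Y \<psi>"
    and id: "ptd_homotopic Y Y (\<psi> \<circ> \<phi>) id"
    by (rule hpol_domination[OF Y])
  have map: "ptd_map (ptd_sphere k) (polyhedron K, v) (\<phi> \<circ> b)" if "b \<in> loops k Y" for b
    using that \<phi> by (auto simp: loops_def ptd_map_def intro: continuous_map_compose)
  have cont: "continuous_map ?S (polyhedron K) (\<phi> \<circ> b)" if "b \<in> loops k Y" for b
    using map[OF that] by (simp add: ptd_map_def ptd_sphere_def)
  \<comment> \<open>\<open>St w\<close> is the preimage under \<open>\<phi>\<close> of the open star
    of the vertex \<open>w\<close>.\<close>
  define St where "St w = {y \<in> topspace (fst Y). 0 < \<phi> y w}" for w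
  have St: "openin (fst Y) (St w)" for w
    using openin_continuous_map_preimage[OF continuous_map_compose[OF _ continuous_map_polyhedron_coordinate],
        of "fst Y" K \<phi> "{0<..}" w] \<phi> by (simp add: St_def ptd_map_def)
  have ca: "continuous_map ?S (fst Y) a"
    using a by (simp add: loops_def ptd_map_def ptd_sphere_def)
  \<comment> \<open>Compact-open subbasic sets need compact test sets, whereas covering arguments
    need open ones. Regularity of the sphere supplies an open \<open>U\<close> around
    \<open>s\<close> inside a compact \<open>C\<close> that \<open>a\<close> maps into a single
    star.\<close>
  have "\<exists>U C w. openin ?S U \<and> compactin ?S C \<and> s \<in> U \<and> U \<subseteq> C \<and> a ` C \<subseteq> St w"
    if s: "s \<in> topspace ?S" for s
  proof -
    have "\<phi> (a s) \<in> topspace (polyhedron K)"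
      using continuous_map_image_subset_topspace[OF cont[OF a]] s by auto
    then obtain w where w: "0 < \<phi> (a s) w"
      using closed_simplex_positive_coordinate by (metis UN_E topspace_polyhedron)
    let ?O = "{s \<in> topspace ?S. a s \<in> St w}"
    have "openin ?S ?O"
      using openin_continuous_map_preimage[OF ca St] .
    moreover have "s \<in> ?O"
      using s w continuous_map_image_subset_topspace[OF ca] by (auto simp: St_def)
    ultimately obtain U V where UV: "openin ?S U" "openin ?S V" "s \<in> U" "topspace ?S - ?O \<subseteq> V"
        "disjnt U V"
      using compact_Hausdorff_imp_regular_space[OF compact_space_nsphere Hausdorff_space_nsphere]
      unfolding regular_space_def by (metis (no_types, lifting) DiffD2 DiffI closedin_def
          openin_closedin_eq s)
    let ?C = "topspace ?S - V"
    have "compactin ?S ?C"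
      using UV(2) by (intro closedin_compact_space compact_space_nsphere) blast
    moreover have "U \<subseteq> ?C"
      using UV(5) openin_subset[OF UV(1)] by (auto simp: disjnt_def)
    moreover have "a ` ?C \<subseteq> St w"
      using UV(4) by blast
    ultimately show ?thesis using UV(1,3) by blast
  qed
  then obtain U C w where UC: "\<And>s. s \<in> topspace ?S \<Longrightarrow> openin ?S (U s) \<and> compactin ?S (C s) \<and> s \<in> U s \<and>
      U s \<subseteq> C s \<and> a ` C s \<subseteq> St (w s)"
    by metis
  have "\<exists>I. finite I \<and> I \<subseteq> topspace ?S \<and> topspace ?S \<subseteq> \<Union>(U ` I)"
  proof -
    have "\<forall>O'\<in>U ` topspace ?S. openin ?S O'" "topspace ?S \<subseteq> \<Union>(U ` topspace ?S)"
      using UC by blast+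
    then obtain \<F> where "finite \<F>" "\<F> \<subseteq> U ` topspace ?S" "topspace ?S \<subseteq> \<Union>\<F>"
      using compact_space_nsphere[of k] unfolding compact_space_def compactin_def by meson
    then show ?thesis by (metis finite_subset_image)
  qed
  then obtain I where I: "finite I" "I \<subseteq> topspace ?S" "topspace ?S \<subseteq> \<Union>(U ` I)"
    by blast
  define N where "N s = {b \<in> loops k Y. b ` C s \<subseteq> St (w s)}" for s
  \<comment> \<open>Intersecting with \<open>loops k Y\<close> keeps \<open>W\<close> a set of loops
    even when the index set is empty.\<close>
  define W where "W = loops k Y \<inter> \<Inter>(N ` I)"
  have N: "openin (loop_space k Y) (N s)" if "s \<in> I" for s
  proof -
    have "compactin ?S (C s)" using UC I(2) that by blast
    then show ?thesis
      unfolding loop_space_def N_def using St by (intro topology_generated_by_Basis) blast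
  qed
  have "openin (loop_space k Y) W"
  proof (cases "I = {}")
    case True
    then show ?thesis
      unfolding W_def by (simp flip: topspace_loop_space)
  next
    case False
    then show ?thesis
      unfolding W_def using I(1) N
      by (intro openin_Int openin_Inter) (auto simp flip: topspace_loop_space)
  qed
  moreover have "a \<in> W"
    using a UC I(2) by (auto simp: W_def N_def)
  moreover have "ptd_homotopic (ptd_sphere k) Y a b" if b: "b \<in> W" for b
  proof -
    let ?P = "(polyhedron K, v)"
    have bl: "b \<in> loops k Y" using b by (simp add: W_def)
    have common: "\<exists>u. 0 < (\<phi> \<circ> a) s u \<and> 0 < (\<phi> \<circ> b) s u" if "s \<in> topspace ?S" for s
    proof -
      obtain i where i: "i \<in> I" "s \<in> U i" using I(3) \<open>s \<in> topspace ?S\<close> by blast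
      then have "i \<in> topspace ?S" using I(2) by blast
      note UCi = UC[OF this]
      have "s \<in> C i" using UCi i(2) by blast
      moreover have "a ` C i \<subseteq> St (w i)" "b ` C i \<subseteq> St (w i)"
        using UCi b i(1) by (auto simp: W_def N_def)
      ultimately have "a s \<in> St (w i)" "b s \<in> St (w i)" by blast+
      then show ?thesis by (auto simp: St_def)
    qed
    have base: "(\<phi> \<circ> c) (snd (ptd_sphere k)) = v" if "c \<in> loops k Y" for c
      using map[OF that] by (simp add: ptd_map_def)
    have "ptd_homotopic (ptd_sphere k) ?P (\<phi> \<circ> a) (\<phi> \<circ> b)"
      using homotopic_with_polyhedron_contiguous[OF K compact_space_nsphere cont[OF a] cont[OF bl] common,
          of "snd (ptd_sphere k)"] base[OF a] base[OF bl] ptd_space_sphere[of k]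
      by (simp add: ptd_homotopic_def ptd_space_def ptd_sphere_def del: o_apply)
    then have "ptd_homotopic (ptd_sphere k) Y (\<psi> \<circ> (\<phi> \<circ> a)) (\<psi> \<circ> (\<phi> \<circ> b))"
      using \<psi> by (intro ptd_homotopic_comp[of _ ?P]) (simp_all add: ptd_homotopic_refl)
    \<comment> \<open>Since \<open>\<psi> \<circ> \<phi>\<close> is homotopic to the identity, the
      round trip through the polyhedron does not change the class of a loop.\<close>
    moreover have "ptd_homotopic (ptd_sphere k) Y (\<psi> \<circ> (\<phi> \<circ> c)) c" if "c \<in> loops k Y" for c
      using ptd_homotopic_comp[OF _ id, of "ptd_sphere k" c c] that
      by (simp add: ptd_homotopic_refl loops_def o_assoc)
    ultimately show ?thesis
      using a bl by (meson ptd_homotopic_sym ptd_homotopic_trans)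
  qed
  ultimately show ?thesis by blast
qed

lemma openin_loop_homotopy_class:
  assumes "hpol V Y"
  shows "openin (loop_space k Y) {b \<in> loops k Y. hclass (ptd_sphere k) Y b = F}"
proof (subst openin_subopen, intro ballI)
  fix a assume "a \<in> {b \<in> loops k Y. hclass (ptd_sphere k) Y b = F}"
  then have a: "a \<in> loops k Y" "hclass (ptd_sphere k) Y a = F" by auto
  obtain W where W: "openin (loop_space k Y) W" "a \<in> W"
      "\<forall>b\<in>W. ptd_homotopic (ptd_sphere k) Y a b"
    using loop_homotopy_neighbourhood[OF assms a(1)] by blast
  have "b \<in> loops k Y \<and> hclass (ptd_sphere k) Y b = F" if "b \<in> W" for b
    using that W(3) a openin_subset[OF W(1)] hclass_eq_iff[of "ptd_sphere k" Y a b]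
    by (auto simp: topspace_loop_space loops_def)
  with W(1,2) show "\<exists>T. openin (loop_space k Y) T \<and> a \<in> T \<and>
      T \<subseteq> {b \<in> loops k Y. hclass (ptd_sphere k) Y b = F}"
    by blast
qed

section \<open>Shape loops and the quotient topology\<close>

text \<open>Elements of \<open>loops\<close> are extensional, so a representing map is restricted to
  the sphere; this changes it only off the carrier and hence not its class.\<close>

lemma hhom_sphere_representative:
  assumes "F \<in> hhom (ptd_sphere k) Y"
  shows "\<exists>a\<in>loops k Y. hclass (ptd_sphere k) Y a = F"
proof -
  obtain f where f: "F = hclass (ptd_sphere k) Y f" "ptd_map (ptd_sphere k) Y f"
    using assms by (auto simp: hhom_def)
  let ?a = "restrict f (topspace (nsphere k))"
  have base: "snd (ptd_sphere k) \<in> topspace (nsphere k)"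
    using ptd_space_sphere[of k] by (simp add: ptd_space_def ptd_sphere_def)
  have hom: "ptd_homotopic (ptd_sphere k) Y f ?a"
    unfolding ptd_homotopic_def
    using f(2) base by (intro homotopic_with_equal) (auto simp: ptd_map_def ptd_sphere_def)
  then show ?thesis
    using f ptd_homotopic_imp_maps(2)[OF hom] hclass_eq_iff[OF f(2), of ?a]
    by (intro bexI[of _ ?a]) (simp_all add: loops_def)
qed

text \<open>Coherence of a shape loop is a condition on homotopy classes, so it is inherited from
  \<open>G\<close> however the representatives are chosen. This independence of coordinates gives
  surjectivity and allows later replacements in single coordinates.\<close>

lemma shape_loops_representative:
  assumes G: "G \<in> shape_morphisms k \<Lambda> le XX p"
    and c: "\<And>i. i \<in> \<Lambda> \<Longrightarrow> c i \<in> loops k (XX i) \<and> hclass (ptd_sphere k) (XX i) (c i) = G i"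
  shows "restrict c \<Lambda> \<in> shape_loops k \<Lambda> le XX p" "shape_loop_class k \<Lambda> XX (restrict c \<Lambda>) = G"
proof -
  show "restrict c \<Lambda> \<in> shape_loops k \<Lambda> le XX p"
    using G c by (auto simp: shape_loops_def shape_morphisms_def)
  have "G \<in> extensional \<Lambda>"
    using G by (auto simp: shape_morphisms_def PiE_iff)
  then show "shape_loop_class k \<Lambda> XX (restrict c \<Lambda>) = G"
    using c by (intro extensionalityI[of _ \<Lambda>]) (auto simp: shape_loop_class_def)
qed

lemma shape_loop_class_in_shape_morphisms:
  assumes "a \<in> shape_loops k \<Lambda> le XX p"
  shows "shape_loop_class k \<Lambda> XX a \<in> shape_morphisms k \<Lambda> le XX p"
proof -
  have "hclass (ptd_sphere k) (XX i) (a i) \<in> hhom (ptd_sphere k) (XX i)" if "i \<in> \<Lambda>" for i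
  proof -
    have "a i \<in> loops k (XX i)" using assms that by (auto simp: shape_loops_def)
    then show ?thesis by (auto simp: loops_def hhom_def)
  qed
  then show ?thesis
    using assms by (auto simp: shape_morphisms_def shape_loops_def shape_loop_class_def)
qed

lemma directed_finite_upper_bound:
  assumes dir: "directed \<Lambda> le" and "finite J" "J \<subseteq> \<Lambda>"
  shows "\<exists>j\<in>\<Lambda>. \<forall>i\<in>J. le i j"
  using assms(2,3)
proof (induction J)
  case empty
  have "\<Lambda> \<noteq> {}" using dir unfolding directed_def by (elim conjE)
  then show ?case by auto
next
  case (insert i J)
  then obtain j where j: "j \<in> \<Lambda>" "\<forall>i\<in>J. le i j" by auto
  have i: "i \<in> \<Lambda>" and J: "J \<subseteq> \<Lambda>" using insert.prems by simp_all
  have "\<forall>i\<in>\<Lambda>. \<forall>j\<in>\<Lambda>. \<exists>k\<in>\<Lambda>. le i k \<and> le j k"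
    using dir unfolding directed_def by (elim conjE)
  with i j(1) obtain l where l: "l \<in> \<Lambda>" "le i l" "le j l" by meson
  have "\<forall>i\<in>\<Lambda>. \<forall>j\<in>\<Lambda>. \<forall>k\<in>\<Lambda>. le i j \<and> le j k \<longrightarrow> le i k"
    using dir unfolding directed_def by (elim conjE)
  then have "le m l" if "m \<in> J" for m
    using that J j l by (meson subsetD)
  with l show ?case by (intro bexI[of _ l]) simp_all
qed

lemma quotient_map_shape_loop_class:
  assumes sys: "hpol_inverse_system V \<Lambda> le XX p"
  shows "quotient_map (shape_loop_space k \<Lambda> le XX p) (shape_group_top k \<Lambda> le XX p)
           (shape_loop_class k \<Lambda> XX)"
proof -
  let ?L = "shape_loops k \<Lambda> le XX p" and ?M = "shape_morphisms k \<Lambda> le XX p"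
    and ?q = "shape_loop_class k \<Lambda> XX" and ?\<Pi> = "product_topology (\<lambda>i. loop_space k (XX i)) \<Lambda>"
  have dir: "directed \<Lambda> le" and hp: "\<And>i. i \<in> \<Lambda> \<Longrightarrow> hpol V (XX i)"
    using sys by (auto simp: hpol_inverse_system_def)
  have rep: "\<exists>c\<in>loops k (XX i). hclass (ptd_sphere k) (XX i) c = G i"
    if "G \<in> ?M" "i \<in> \<Lambda>" for G i
    using that by (intro hhom_sphere_representative) (auto simp: shape_morphisms_def)
  have "G \<in> ?q ` ?L" if G: "G \<in> ?M" for G
  proof -
    obtain c where "\<And>i. i \<in> \<Lambda> \<Longrightarrow> c i \<in> loops k (XX i) \<and> hclass (ptd_sphere k) (XX i) (c i) = G i"
      using rep[OF G] by metis
    from shape_loops_representative[OF G this] show ?thesis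
      by (metis image_eqI)
  qed
  then have surj: "?q ` ?L = ?M"
    using shape_loop_class_in_shape_morphisms by blast
  have "openin (shape_loop_space k \<Lambda> le XX p) {a \<in> ?L. ?q a \<in> U}"
    if U: "openin (shape_group_top k \<Lambda> le XX p) U" for U
  proof (subst openin_subopen, intro ballI)
    fix a assume "a \<in> {a \<in> ?L. ?q a \<in> U}"
    then have a: "a \<in> ?L" "?q a \<in> U" by auto
    then obtain i where i: "i \<in> \<Lambda>" "shape_basic k \<Lambda> le XX p i (?q a) \<subseteq> U"
      using U unfolding openin_shape_group_top[OF dir] by blast
    let ?B = "{b \<in> loops k (XX i). hclass (ptd_sphere k) (XX i) b = ?q a i}"
    \<comment> \<open>Fixing the class of coordinate \<open>i\<close> is an open condition on shape
      loops, because homotopy classes are open in the loop space of \<open>XX i\<close>.\<close>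
    let ?T = "{b \<in> topspace ?\<Pi>. b i \<in> ?B} \<inter> ?L"
    have "openin ?\<Pi> {b \<in> topspace ?\<Pi>. b i \<in> ?B}"
      by (intro openin_continuous_map_preimage[OF continuous_map_product_projection] i(1)
          openin_loop_homotopy_class[OF hp[OF i(1)]])
    then have "openin (shape_loop_space k \<Lambda> le XX p) ?T"
      unfolding shape_loop_space_def by (rule openin_subtopology_Int)
    moreover have "?L \<subseteq> topspace ?\<Pi>"
      by (auto simp: shape_loops_def topspace_loop_space)
    then have "a \<in> ?T"
      using a(1) i(1) by (auto simp: shape_loop_class_def shape_loops_def)
    moreover have "?q b \<in> U" if "b \<in> ?T" for b
    proof -
      have "?q b \<in> ?M" "?q a i = ?q b i"
        using that i(1) shape_loop_class_in_shape_morphisms by (auto simp: shape_loop_class_def)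
      then show ?thesis using i(2) by (auto simp: shape_basic_def)
    qed
    ultimately show "\<exists>T. openin (shape_loop_space k \<Lambda> le XX p) T \<and> a \<in> T \<and> T \<subseteq> {a \<in> ?L. ?q a \<in> U}"
      by blast
  qed
  \<comment> \<open>The converse: a set of shape morphisms with open preimage is open.\<close>
  moreover have "openin (shape_group_top k \<Lambda> le XX p) U"
    if U: "U \<subseteq> ?M" and op: "openin (shape_loop_space k \<Lambda> le XX p) {a \<in> ?L. ?q a \<in> U}" for U
    unfolding openin_shape_group_top[OF dir]
  proof (intro conjI U ballI)
    fix F assume "F \<in> U"
    then have "F \<in> ?q ` ?L" unfolding surj by (rule subsetD[OF U])
    then obtain a where a: "a \<in> ?L" "?q a = F" by (metis imageE)
    obtain T where T: "openin ?\<Pi> T" "{a \<in> ?L. ?q a \<in> U} = T \<inter> ?L"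
      using op by (auto simp: shape_loop_space_def openin_subtopology)
    have "a \<in> T" using T(2) a \<open>F \<in> U\<close> by blast
    from T(1)[unfolded openin_product_topology_alt, rule_format, OF this]
    obtain N where N: "finite {i \<in> \<Lambda>. N i \<noteq> topspace (loop_space k (XX i))}"
        "a \<in> PiE \<Lambda> N" "PiE \<Lambda> N \<subseteq> T"
      by meson
    \<comment> \<open>Only finitely many factors of the basic box differ from the whole loop space;
      \<open>j\<close> is an upper bound of their indices.\<close>
    then obtain j where j: "j \<in> \<Lambda>" "\<And>i. i \<in> \<Lambda> \<Longrightarrow> N i \<noteq> loops k (XX i) \<Longrightarrow> le i j"
      using directed_finite_upper_bound[OF dir N(1)] by (auto simp: topspace_loop_space)
    have "G \<in> U" if "G \<in> shape_basic k \<Lambda> le XX p j F" for G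
    proof -
      have G: "G \<in> ?M" "F j = G j" using that by (auto simp: shape_basic_def)
      have F: "F \<in> ?M" using \<open>F \<in> U\<close> U by blast
      \<comment> \<open>Agreement at \<open>j\<close> descends along the bonding morphism
        \<open>p i j\<close> to every restricted coordinate \<open>i\<close>.\<close>
      have eq: "F i = G i" if "i \<in> \<Lambda>" "N i \<noteq> loops k (XX i)" for i
      proof -
        have "hcomp (ptd_sphere k) (XX i) (p i j) (H j) = H i" if "H \<in> ?M" for H
          using that \<open>i \<in> \<Lambda>\<close> j(1) j(2)[OF \<open>i \<in> \<Lambda>\<close> \<open>N i \<noteq> _\<close>] by (auto simp: shape_morphisms_def)
        then show ?thesis using F G by metis
      qed
      \<comment> \<open>In restricted coordinates \<open>a i\<close> itself represents
        \<open>G i\<close> and lies in \<open>N i\<close>; elsewhere any representative of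
        \<open>G i\<close> will do.\<close>
      have "\<exists>c. c \<in> loops k (XX i) \<and> hclass (ptd_sphere k) (XX i) c = G i \<and> c \<in> N i"
        if i: "i \<in> \<Lambda>" for i
      proof (cases "N i = loops k (XX i)")
        case True
        then show ?thesis using rep[OF G(1) i] by blast
      next
        case False
        have "a i \<in> loops k (XX i)" using a(1) i by (auto simp: shape_loops_def)
        moreover have "hclass (ptd_sphere k) (XX i) (a i) = F i"
          using a(2) i by (auto simp: shape_loop_class_def)
        moreover have "a i \<in> N i" using N(2) i by blast
        ultimately show ?thesis using eq[OF i False] by auto
      qed
      then obtain c where c: "\<And>i. i \<in> \<Lambda> \<Longrightarrow> c i \<in> loops k (XX i) \<and>
          hclass (ptd_sphere k) (XX i) (c i) = G i \<and> c i \<in> N i"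
        by metis
      then have cG: "restrict c \<Lambda> \<in> ?L" "?q (restrict c \<Lambda>) = G"
        using shape_loops_representative[OF G(1), of c] by blast+
      have "restrict c \<Lambda> \<in> PiE \<Lambda> N" using c by auto
      then have "restrict c \<Lambda> \<in> T \<inter> ?L" using N(3) cG(1) by blast
      then show ?thesis using cG(2) T(2) by blast
    qed
    then show "\<exists>i\<in>\<Lambda>. shape_basic k \<Lambda> le XX p i F \<subseteq> U"
      using j(1) by blast
  qed
  ultimately show ?thesis
    using surj
    by (auto simp: quotient_map_def topspace_shape_loop_space topspace_shape_group_top[OF dir])
qed

theorem theorem4p15:
  fixes X :: "'a topology" and x :: 'a
    and \<Lambda> :: "'i set" and le :: "'i \<Rightarrow> 'i \<Rightarrow> bool"
    and XX :: "'i \<Rightarrow> 'b topology \<times> 'b"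
    and p :: "'i \<Rightarrow> 'i \<Rightarrow> ('b \<Rightarrow> 'b) set"
    and pr :: "'i \<Rightarrow> ('a \<Rightarrow> 'b) set"
    and k :: nat
  assumes "ptd_space (X, x)"
    and "hpol_expansion TYPE('v) TYPE('p) (X, x) \<Lambda> le XX p pr"
    and "k \<ge> 1"
  shows "quotient_map (shape_loop_space k \<Lambda> le XX p) (shape_group_top k \<Lambda> le XX p)
           (shape_loop_class k \<Lambda> XX)"
  using assms(2) by (intro quotient_map_shape_loop_class) (auto simp: hpol_expansion_def)

end
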